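(* Let $k\ge 1$, let $G_k$ be the group of $k$-jets at $0$ of reparametrizations of $(\mathbb{C},0)$, and let $\mathfrak{g}_k=\mathrm{Lie}(G_k)$. The adjoint action of $G_k$ on $\mathfrak{g}_k$ has a generic stabilizer. In particular, the Cartan subalgebras of $\mathfrak{g}_k$ are commutative.
   Context: $G_k\subset GL_k(\mathbb{C})$ is the complex algebraic group of all upper triangular $k\times k$ matrices $A(a_1,\dots,a_k)$, $a_1\in\mathbb{C}^*$, $a_2,\dots,a_k\in\mathbb{C}$, with entries $A_{ij}=\sum_{s_1+\cdots+s_i=j,\ s_l\ge 1} a_{s_1}\cdots a_{s_i}$. It corresponds to the group of reparametrizations $t\mapsto a_1t+a_2t^2+\cdots+a_kt^k$ modulo $t^{k+1}$. One has $G_k=\mathbb{C}^*\ltimes U_k$, where $U_k=\{a_1=1\}$ is the unipotent radical. Generic stabilizer: let an algebraic group $G$ with Lie algebra $\mathfrak{g}$ act on a variety $X$; for $x\in X$ let $G_x$ be the stabilizer and $\mathfrak{g}_x=\mathrm{Lie}(G_x)$. The action has a generic stabilizer if there is an open dense subset $U\subset X$ such that all the subalgebras $\mathfrak{g}_x$, $x\in U$, are $G$-conjugate. For the adjoint action, $\mathfrak{g}_x=\mathfrak{z}_{\mathfrak{g}}(x)$ is the centralizer of $x$. A Cartan subalgebra of a Lie algebra $\mathfrak{g}$ is a nilpotent subalgebra $\mathfrak{h}$ equal to its own normalizer $\mathfrak{n}_{\mathfrak{g}}(\mathfrak{h})$. *)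

theory Defs
  imports
    "HOL-Analysis.Analysis"
    "HOL-Algebra.Group_Action"
    "Jordan_Normal_Form.Matrix"
begin

subsection \<open>The jet group\<close>

text \<open>Compositions \<open>j = s\<^sub>1 + \<dots> + s\<^sub>i\<close> into \<open>i\<close> positive parts, as lists.\<close>

definition compositions :: "nat \<Rightarrow> nat \<Rightarrow> nat list set" where
  "compositions i j = {s. length s = i \<and> (\<forall>l\<in>set s. 1 \<le> l) \<and> sum_list s = j}"

text \<open>The library's matrices are indexed from 0, so position \<open>(i, j)\<close> holds the entry
  \<open>A\<^bsub>i+1,j+1\<^esub>\<close> of the usual notation, which is the coefficient of \<open>t\<^bsup>j+1\<^esup>\<close> in the power
  \<open>i + 1\<close> of \<open>a\<^sub>1 t + a\<^sub>2 t\<^sup>2 + \<dots> + a\<^sub>k t\<^sup>k\<close>. Only \<open>a 1, \<dots>, a k\<close> are used.\<close>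

definition jet_matrix :: "nat \<Rightarrow> (nat \<Rightarrow> complex) \<Rightarrow> complex mat" where
  "jet_matrix k a = mat k k (\<lambda>(i, j). \<Sum>s\<in>compositions (i + 1) (j + 1). prod_list (map a s))"

definition jet_group :: "nat \<Rightarrow> complex mat monoid" where
  "jet_group k = \<lparr>carrier = {jet_matrix k a | a. a 1 \<noteq> 0}, mult = (*), one = 1\<^sub>m k\<rparr>"

subsection \<open>Polynomial functions and the Zariski topology on square matrices\<close>

inductive_set poly_funs :: "nat \<Rightarrow> (complex mat \<Rightarrow> complex) set" for k :: nat where
  const: "(\<lambda>X. c) \<in> poly_funs k"
| entry: "i < k \<Longrightarrow> j < k \<Longrightarrow> (\<lambda>X. X $$ (i, j)) \<in> poly_funs k"
| add: "f \<in> poly_funs k \<Longrightarrow> g \<in> poly_funs k \<Longrightarrow> (\<lambda>X. f X + g X) \<in> poly_funs k"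
| mult: "f \<in> poly_funs k \<Longrightarrow> g \<in> poly_funs k \<Longrightarrow> (\<lambda>X. f X * g X) \<in> poly_funs k"

definition zariski :: "nat \<Rightarrow> complex mat topology" where
  "zariski k = topology_generated_by {{X \<in> carrier_mat k k. f X \<noteq> 0} | f. f \<in> poly_funs k}"

subsection \<open>Lie algebras of linear algebraic groups\<close>

text \<open>The Lie algebra of an algebraic subgroup \<open>G\<close> of \<open>GL\<^sub>k\<close> is the Zariski tangent space of
  \<open>G\<close> at the identity: the matrices \<open>X\<close> along which the differential at the identity of every
  polynomial vanishing on \<open>G\<close> is zero. The bracket is the commutator of matrices.\<close>

definition lie_alg :: "nat \<Rightarrow> complex mat set \<Rightarrow> complex mat set" where
  "lie_alg k G = {X \<in> carrier_mat k k. \<forall>f\<in>poly_funs k. (\<forall>g\<in>G. f g = 0) \<longrightarrow>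
     ((\<lambda>z. f (1\<^sub>m k + z \<cdot>\<^sub>m X)) has_field_derivative 0) (at 0)}"

definition lie_bracket :: "complex mat \<Rightarrow> complex mat \<Rightarrow> complex mat" where
  "lie_bracket X Y = X * Y - Y * X"

definition Ad :: "complex mat monoid \<Rightarrow> complex mat \<Rightarrow> complex mat \<Rightarrow> complex mat" where
  "Ad G g X = g * X * inv\<^bsub>G\<^esub> g"

definition jet_algebra :: "nat \<Rightarrow> complex mat set" where
  "jet_algebra k = lie_alg k (carrier (jet_group k))"

subsection \<open>Generic stabilizers\<close>

text \<open>\<open>G\<close> is an algebraic subgroup of \<open>GL\<^sub>k\<close> acting by \<open>\<phi>\<close> on a variety with Zariski topology
  \<open>T\<close>; \<open>stabilizer\<close> is the one of HOL-Algebra.\<close>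

definition has_generic_stabilizer ::
    "nat \<Rightarrow> complex mat monoid \<Rightarrow> (complex mat \<Rightarrow> 'x \<Rightarrow> 'x) \<Rightarrow> 'x topology \<Rightarrow> bool" where
  "has_generic_stabilizer k G \<phi> T \<longleftrightarrow>
     (\<exists>U. openin T U \<and> T closure_of U = topspace T \<and>
       (\<forall>x\<in>U. \<forall>y\<in>U. \<exists>g\<in>carrier G.
          lie_alg k (stabilizer G \<phi> y) = Ad G g ` lie_alg k (stabilizer G \<phi> x)))"

subsection \<open>Cartan subalgebras of matrix Lie algebras\<close>

definition mat_subspace :: "nat \<Rightarrow> complex mat set \<Rightarrow> bool" where
  "mat_subspace k V \<longleftrightarrow> V \<subseteq> carrier_mat k k \<and> 0\<^sub>m k k \<in> V \<and>
     (\<forall>X\<in>V. \<forall>Y\<in>V. X + Y \<in> V) \<and> (\<forall>c. \<forall>X\<in>V. c \<cdot>\<^sub>m X \<in> V)"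

definition lie_subalgebra :: "nat \<Rightarrow> complex mat set \<Rightarrow> complex mat set \<Rightarrow> bool" where
  "lie_subalgebra k \<gg> \<hh> \<longleftrightarrow>
     mat_subspace k \<hh> \<and> \<hh> \<subseteq> \<gg> \<and> (\<forall>X\<in>\<hh>. \<forall>Y\<in>\<hh>. lie_bracket X Y \<in> \<hh>)"

primrec lower_central :: "nat \<Rightarrow> complex mat set \<Rightarrow> nat \<Rightarrow> complex mat set" where
  "lower_central k \<hh> 0 = \<hh>"
| "lower_central k \<hh> (Suc n) =
     mat_subspace k hull {lie_bracket X Y | X Y. X \<in> \<hh> \<and> Y \<in> lower_central k \<hh> n}"

definition lie_nilpotent :: "nat \<Rightarrow> complex mat set \<Rightarrow> bool" where
  "lie_nilpotent k \<hh> \<longleftrightarrow> (\<exists>n. lower_central k \<hh> n = {0\<^sub>m k k})"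

definition lie_normalizer :: "complex mat set \<Rightarrow> complex mat set \<Rightarrow> complex mat set" where
  "lie_normalizer \<gg> \<hh> = {X \<in> \<gg>. \<forall>Y\<in>\<hh>. lie_bracket X Y \<in> \<hh>}"

definition cartan_subalgebra :: "nat \<Rightarrow> complex mat set \<Rightarrow> complex mat set \<Rightarrow> bool" where
  "cartan_subalgebra k \<gg> \<hh> \<longleftrightarrow>
     lie_subalgebra k \<gg> \<hh> \<and> lie_nilpotent k \<hh> \<and> \<hh> = lie_normalizer \<gg> \<hh>"

definition lie_commutative :: "nat \<Rightarrow> complex mat set \<Rightarrow> bool" where
  "lie_commutative k \<hh> \<longleftrightarrow> (\<forall>X\<in>\<hh>. \<forall>Y\<in>\<hh>. lie_bracket X Y = 0\<^sub>m k k)"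

end

theory Submission
  imports Defs
begin

text \<open>The matrix of a jet \<open>f\<close> has as rows the coefficients of the powers of \<open>f\<close>, so the matrix product is
  composition, and the Lie algebra consists of the derivations \<open>v(t) d/dt\<close> with \<open>v(0) = 0\<close>. When
  \<open>c = v'(0)\<close> is nonzero, the equation \<open>v f' = c f\<close> has a solution \<open>f\<close> invertible under composition,
  and its matrix conjugates \<open>v(t) d/dt\<close> to \<open>c t d/dt\<close>, a multiple of \<open>diag(1, \<dots>, k)\<close>. Hence any two
  elements of the open dense set \<open>v'(0) \<noteq> 0\<close> are conjugate up to a nonzero scalar, so their stabilizers,
  and the Lie algebras of these, are conjugate.

  A Cartan subalgebra contained in \<open>v'(0) = 0\<close> would not be self-normalizing, because bracketing with
  such fields raises the order of vanishing. So it contains an element conjugate to \<open>c t d/dt\<close>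
  with \<open>c \<noteq> 0\<close>. The adjoint action of that element is both diagonalizable and, on the subalgebra,
  nilpotent; hence the subalgebra is conjugate to a space of diagonal matrices.\<close>

subsection \<open>The jet group in terms of power series\<close>

text \<open>Representing a jet by a full power series makes composition, inversion and
  differentiation available. When the constant term is 0, only the coefficients of degree at most
  \<open>k\<close> enter the matrix.\<close>

definition jet_mat :: "nat \<Rightarrow> complex fps \<Rightarrow> complex mat" where
  "jet_mat k f = mat k k (\<lambda>(i, j). fps_nth (f ^ Suc i) (Suc j))"

text \<open>The action of \<open>v(t) d/dt\<close>: row \<open>i\<close> is the image of \<open>t\<^bsup>i+1\<^esup>\<close>.\<close>

definition vf_mat :: "nat \<Rightarrow> complex fps \<Rightarrow> complex mat" where
  "vf_mat k v = mat k k (\<lambda>(i, j). fps_nth (fps_deriv (fps_X ^ Suc i) * v) (Suc j))"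

lemma jet_mat_carrier [simp]: "jet_mat k f \<in> carrier_mat k k"
  by (simp add: jet_mat_def)

lemma vf_mat_carrier [simp]: "vf_mat k v \<in> carrier_mat k k"
  by (simp add: vf_mat_def)

lemma jet_mat_index:
  "i < k \<Longrightarrow> j < k \<Longrightarrow> jet_mat k f $$ (i, j) = fps_nth (f ^ Suc i) (Suc j)"
  by (simp add: jet_mat_def)

lemma vf_mat_index_conv:
  "i < k \<Longrightarrow> j < k \<Longrightarrow> vf_mat k v $$ (i, j) = fps_nth (fps_deriv (fps_X ^ Suc i) * v) (Suc j)"
  by (simp add: vf_mat_def)

text \<open>For \<open>i \<ge> Suc j\<close> natural subtraction yields index 0, where
  \<open>v\<close> vanishes, so the same formula covers the zero entries below the diagonal.\<close>

lemma vf_mat_index: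
  assumes "i < k" "j < k" "fps_nth v 0 = 0"
  shows "vf_mat k v $$ (i, j) = of_nat (Suc i) * fps_nth v (Suc j - i)"
  using assms
  by (simp add: vf_mat_def fps_deriv_power mult.assoc fps_X_power_mult_nth del: power_Suc of_nat_Suc)

lemma prod_list_map_nth:
  fixes f :: "'a \<Rightarrow> 'b :: comm_monoid_mult"
  shows "prod_list (map f xs) = (\<Prod>i<length xs. f (xs ! i))"
  by (induction xs) (simp_all add: prod.lessThan_Suc_shift del: prod.lessThan_Suc)

text \<open>The coefficient of a power is a sum over all lists of nonnegative exponents with given
  length and sum. A zero constant term kills every list containing 0, which leaves exactly the
  compositions.\<close>

lemma jet_matrix_eq_jet_mat:
  "jet_matrix k a = jet_mat k (Abs_fps (\<lambda>n. if n = 0 then 0 else a n))"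
proof (rule eq_matI)
  fix i j assume ij: "i < dim_row (jet_mat k (Abs_fps (\<lambda>n. if n = 0 then 0 else a n)))"
    "j < dim_col (jet_mat k (Abs_fps (\<lambda>n. if n = 0 then 0 else a n)))"
  let ?b = "\<lambda>n. if n = 0 then 0 else a n"
  have fin: "finite (natpermute (Suc j) (Suc i))"
    by (rule natpermute_finite)
  have sub: "compositions (Suc i) (Suc j) \<subseteq> natpermute (Suc j) (Suc i)"
    by (auto simp: compositions_def natpermute_def)
  have "fps_nth (Abs_fps ?b ^ Suc i) (Suc j)
      = (\<Sum>v\<in>natpermute (Suc j) (Suc i). \<Prod>l=0..i. ?b (v ! l))"
    unfolding fps_power_nth_Suc by simp
  also have "\<dots> = (\<Sum>v\<in>natpermute (Suc j) (Suc i). prod_list (map ?b v))"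
    by (intro sum.cong refl)
      (auto simp: natpermute_def prod_list_map_nth atLeast0AtMost lessThan_Suc_atMost intro!: prod.cong)
  also have "\<dots> = (\<Sum>v\<in>compositions (Suc i) (Suc j). prod_list (map ?b v))"
  proof (rule sum.mono_neutral_right[OF fin sub], rule ballI)
    fix v assume "v \<in> natpermute (Suc j) (Suc i) - compositions (Suc i) (Suc j)"
    then have "0 \<in> set v"
      by (auto simp: compositions_def natpermute_def not_less_eq_eq)
    then show "prod_list (map ?b v) = 0"
      by (force simp: prod_list_zero_iff)
  qed
  also have "\<dots> = (\<Sum>v\<in>compositions (Suc i) (Suc j). prod_list (map a v))"
    by (intro sum.cong refl arg_cong[where f = prod_list] map_cong) (auto simp: compositions_def)
  finally show "jet_matrix k a $$ (i, j) = jet_mat k (Abs_fps ?b) $$ (i, j)"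
    using ij by (simp add: jet_matrix_def jet_mat_def)
qed (auto simp: jet_matrix_def jet_mat_def)

lemma carrier_jet_group:
  "carrier (jet_group k) = {jet_mat k f | f. fps_nth f 0 = 0 \<and> fps_nth f 1 \<noteq> 0}"
proof (intro equalityI subsetI)
  fix g assume "g \<in> carrier (jet_group k)"
  then obtain a where "g = jet_matrix k a" "a 1 \<noteq> 0"
    by (auto simp: jet_group_def)
  then show "g \<in> {jet_mat k f | f. fps_nth f 0 = 0 \<and> fps_nth f 1 \<noteq> 0}"
    by (auto simp: jet_matrix_eq_jet_mat intro!: exI[where x = "Abs_fps (\<lambda>n. if n = 0 then 0 else a n)"])
next
  fix g assume "g \<in> {jet_mat k f | f. fps_nth f 0 = 0 \<and> fps_nth f 1 \<noteq> 0}"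
  then obtain f where f: "g = jet_mat k f" "fps_nth f 0 = 0" "fps_nth f 1 \<noteq> 0"
    by auto
  have "Abs_fps (\<lambda>n. if n = 0 then 0 else fps_nth f n) = f"
    using f by (auto simp: fps_eq_iff)
  then have "g = jet_matrix k (fps_nth f)"
    using f by (simp add: jet_matrix_eq_jet_mat)
  then show "g \<in> carrier (jet_group k)"
    using f by (auto simp: jet_group_def)
qed

text \<open>A series without constant term is read as the row vector of its coefficients;
  multiplying this row by a jet matrix is substitution into the series.\<close>

lemma sum_coeff_jet_mat:
  assumes "fps_nth p 0 = 0" "fps_nth g 0 = 0" "l < k"
  shows "(\<Sum>j<k. fps_nth p (Suc j) * jet_mat k g $$ (j, l)) = fps_nth (p oo g) (Suc l)"
proof -
  have "fps_nth (p oo g) (Suc l) = (\<Sum>j=0..Suc l. fps_nth p j * fps_nth (g ^ j) (Suc l))"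
    by (rule fps_compose_nth)
  \<comment> \<open>The range may be enlarged from \<open>Suc l\<close> to \<open>k\<close>, since
    \<open>g ^ j\<close> has no coefficient below degree \<open>j\<close>.\<close>
  also have "\<dots> = (\<Sum>j\<le>k. fps_nth p j * fps_nth (g ^ j) (Suc l))"
  proof (rule sum.mono_neutral_left)
    show "\<forall>j\<in>{..k} - {0..Suc l}. fps_nth p j * fps_nth (g ^ j) (Suc l) = 0"
      using startsby_zero_power_prefix[OF assms(2)] by auto
  qed (use assms in auto)
  also have "\<dots> = (\<Sum>j<k. fps_nth p (Suc j) * fps_nth (g ^ Suc j) (Suc l))"
    using assms(1) by (simp add: sum.atMost_shift del: power_Suc)
  finally show ?thesis
    using assms(3) by (simp add: jet_mat_index del: power_Suc)
qed

text \<open>The infinitesimal counterpart of \<open>sum_coeff_jet_mat\<close>: the row of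
  \<open>p\<close> is sent to the row of its derivative along the vector field.\<close>

lemma sum_coeff_vf_mat:
  assumes "fps_nth v 0 = 0" "l < k"
  shows "(\<Sum>j<k. fps_nth p (Suc j) * vf_mat k v $$ (j, l)) = fps_nth (fps_deriv p * v) (Suc l)"
proof -
  have "fps_nth (fps_deriv p * v) (Suc l)
      = (\<Sum>j=0..Suc l. fps_nth (fps_deriv p) j * fps_nth v (Suc l - j))"
    by (rule fps_mult_nth)
  also have "\<dots> = (\<Sum>j\<le>l. fps_nth (fps_deriv p) j * fps_nth v (Suc l - j))"
    using assms by (simp add: atLeast0AtMost)
  \<comment> \<open>For \<open>j > l\<close> the index \<open>Suc l - j\<close> is truncated to 0,
    so the added terms contain the factor \<open>fps_nth v 0 = 0\<close>.\<close>
  also have "\<dots> = (\<Sum>j<k. fps_nth (fps_deriv p) j * fps_nth v (Suc l - j))"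
    using assms by (intro sum.mono_neutral_left) auto
  also have "\<dots> = (\<Sum>j<k. fps_nth p (Suc j) * vf_mat k v $$ (j, l))"
    using assms by (intro sum.cong refl) (simp add: vf_mat_index mult_ac)
  finally show ?thesis by simp
qed

lemma index_mult_mat_sum:
  assumes "A \<in> carrier_mat k k" "B \<in> carrier_mat k k" "i < k" "l < k"
  shows "(A * B) $$ (i, l) = (\<Sum>j<k. A $$ (i, j) * B $$ (j, l))"
  using assms by (auto simp: scalar_prod_def lessThan_atLeast0 intro!: sum.cong)

lemma jet_mat_mult:
  assumes "fps_nth f 0 = 0" "fps_nth g 0 = 0"
  shows "jet_mat k f * jet_mat k g = jet_mat k (f oo g)"
proof (rule eq_matI)
  fix i l assume "i < dim_row (jet_mat k (f oo g))" "l < dim_col (jet_mat k (f oo g))"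
  then have il: "i < k" "l < k" by (auto simp: jet_mat_def)
  have "(jet_mat k f * jet_mat k g) $$ (i, l)
      = (\<Sum>j<k. fps_nth (f ^ Suc i) (Suc j) * jet_mat k g $$ (j, l))"
    using il by (subst index_mult_mat_sum[where k = k]) (auto simp: jet_mat_index simp del: power_Suc)
  also have "\<dots> = fps_nth (f ^ Suc i oo g) (Suc l)"
    using assms il by (intro sum_coeff_jet_mat) auto
  finally show "(jet_mat k f * jet_mat k g) $$ (i, l) = jet_mat k (f oo g) $$ (i, l)"
    using il assms by (simp add: jet_mat_index fps_compose_power del: power_Suc)
qed (auto simp: jet_mat_def)

lemma jet_mat_mult_vf_mat:
  assumes "fps_nth v 0 = 0" "i < k" "l < k"
  shows "(jet_mat k f * vf_mat k v) $$ (i, l) = fps_nth (fps_deriv (f ^ Suc i) * v) (Suc l)"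
  using assms
  by (subst index_mult_mat_sum[where k = k])
    (auto simp: jet_mat_index sum_coeff_vf_mat simp del: power_Suc)

lemma jet_mat_X: "jet_mat k fps_X = 1\<^sub>m k"
  by (rule eq_matI) (auto simp: jet_mat_def fps_X_power_nth simp del: power_Suc)

lemma jet_mat_inverse:
  assumes "fps_nth f 0 = 0" "fps_nth f 1 \<noteq> 0"
  shows "jet_mat k (fps_inv f) * jet_mat k f = 1\<^sub>m k" "jet_mat k f * jet_mat k (fps_inv f) = 1\<^sub>m k"
    and "fps_nth (fps_inv f) 0 = 0" "fps_nth (fps_inv f) 1 \<noteq> 0"
proof -
  show 0: "fps_nth (fps_inv f) 0 = 0" by (simp add: fps_inv_def)
  show "fps_nth (fps_inv f) 1 \<noteq> 0" using assms by (simp add: fps_inv_def)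
  show "jet_mat k (fps_inv f) * jet_mat k f = 1\<^sub>m k"
    using assms 0 by (simp add: jet_mat_mult fps_inv jet_mat_X)
  show "jet_mat k f * jet_mat k (fps_inv f) = 1\<^sub>m k"
    using assms 0 by (simp add: jet_mat_mult fps_inv_right jet_mat_X)
qed

section \<open>The group structure on jets\<close>

lemma jet_group_group: "group (jet_group k)"
proof (rule groupI)
  fix x y assume "x \<in> carrier (jet_group k)" "y \<in> carrier (jet_group k)"
  then obtain f g where x: "x = jet_mat k f" "fps_nth f 0 = 0" "fps_nth f 1 \<noteq> 0"
    and y: "y = jet_mat k g" "fps_nth g 0 = 0" "fps_nth g 1 \<noteq> 0"
    by (auto simp: carrier_jet_group)
  have "fps_nth (f oo g) 1 \<noteq> 0"
    using x y by (simp add: fps_compose_nth)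
  then show "x \<otimes>\<^bsub>jet_group k\<^esub> y \<in> carrier (jet_group k)"
    unfolding carrier_jet_group using x y
    by (auto simp: jet_group_def jet_mat_mult)
next
  show "\<one>\<^bsub>jet_group k\<^esub> \<in> carrier (jet_group k)"
    unfolding carrier_jet_group 
    by (auto simp: jet_group_def jet_mat_X[symmetric] intro!: exI[where x = fps_X])
next
  fix x y z assume "x \<in> carrier (jet_group k)" "y \<in> carrier (jet_group k)" "z \<in> carrier (jet_group k)"
  then have "x \<in> carrier_mat k k" "y \<in> carrier_mat k k" "z \<in> carrier_mat k k"
    by (auto simp: carrier_jet_group)
  then show "x \<otimes>\<^bsub>jet_group k\<^esub> y \<otimes>\<^bsub>jet_group k\<^esub> z = x \<otimes>\<^bsub>jet_group k\<^esub> (y \<otimes>\<^bsub>jet_group k\<^esub> z)"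
    by (simp add: jet_group_def)
next
  fix x assume "x \<in> carrier (jet_group k)"
  then obtain f where x: "x = jet_mat k f" "fps_nth f 0 = 0" "fps_nth f 1 \<noteq> 0"
    by (auto simp: carrier_jet_group)
  then show "\<one>\<^bsub>jet_group k\<^esub> \<otimes>\<^bsub>jet_group k\<^esub> x = x"
    by (simp add: jet_group_def left_mult_one_mat[OF jet_mat_carrier])
  show "\<exists>y\<in>carrier (jet_group k). y \<otimes>\<^bsub>jet_group k\<^esub> x = \<one>\<^bsub>jet_group k\<^esub>"
    using x jet_mat_inverse[OF x(2,3)] unfolding carrier_jet_group
    by (auto simp: jet_group_def intro!: exI[where x = "jet_mat k (fps_inv f)"])
qed

lemma jet_group_invD:
  assumes "g \<in> carrier (jet_group k)"
  shows "g \<in> carrier_mat k k" "inv\<^bsub>jet_group k\<^esub> g \<in> carrier_mat k k"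
    "inv\<^bsub>jet_group k\<^esub> g \<in> carrier (jet_group k)"
    "g * inv\<^bsub>jet_group k\<^esub> g = 1\<^sub>m k" "inv\<^bsub>jet_group k\<^esub> g * g = 1\<^sub>m k"
proof -
  interpret group "jet_group k" by (rule jet_group_group)
  show g: "inv\<^bsub>jet_group k\<^esub> g \<in> carrier (jet_group k)"
    using assms by simp
  show "g \<in> carrier_mat k k" "inv\<^bsub>jet_group k\<^esub> g \<in> carrier_mat k k"
    using assms g by (auto simp: carrier_jet_group)
  show "g * inv\<^bsub>jet_group k\<^esub> g = 1\<^sub>m k" "inv\<^bsub>jet_group k\<^esub> g * g = 1\<^sub>m k"
    using r_inv[OF assms] l_inv[OF assms] by (auto simp: jet_group_def)
qed

text \<open>Writing \<open>v = t w\<close> and \<open>f = t u\<close>, the equation becomes \<open>u' = u q\<close> with \<open>t q = c / w - 1\<close>.\<close>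

lemma linearizing_jet:
  fixes v :: "complex fps"
  assumes "fps_nth v 0 = 0" "fps_nth v 1 \<noteq> 0"
  obtains f where "fps_nth f 0 = 0" "fps_nth f 1 \<noteq> 0"
    "fps_deriv f * v = fps_const (fps_nth v 1) * f"
proof -
  define c where "c = fps_nth v 1"
  define w where "w = fps_shift 1 v"
  have v: "v = fps_X * w"
    using assms(1) by (auto simp: w_def fps_eq_iff)
  have w0: "fps_nth w 0 = c" "c \<noteq> 0" using assms by (auto simp: w_def c_def)
  define p where "p = fps_const c * inverse w"
  have p: "p * w = fps_const c"
    using w0 by (simp add: p_def mult.assoc inverse_mult_eq_1)
  have p0: "fps_nth p 0 = 1"
    using w0 by (simp add: p_def)
  \<comment> \<open>Divisibility of \<open>p - 1\<close> by \<open>fps_X\<close> requires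
    \<open>p\<close> to have constant term 1; this forces the eigenvalue \<open>c\<close> to be the
    linear coefficient of \<open>v\<close>.\<close>
  define q where "q = fps_shift 1 (p - 1)"
  have q: "fps_X * q = p - 1"
    using p0 by (auto simp: q_def fps_eq_iff)
  \<comment> \<open>The exponential of an antiderivative of \<open>q\<close> is the solution of u' =
    u q with constant term 1.\<close>
  define u where "u = fps_exp 1 oo fps_integral0 q"
  have du: "fps_deriv u = u * q"
    unfolding u_def by (subst fps_compose_deriv) (auto simp: fps_deriv_fps_integral)
  have u0: "fps_nth u 0 = 1" by (simp add: u_def)
  have "fps_deriv (fps_X * u) * v = (u + u * (fps_X * q)) * v"
    by (simp add: du algebra_simps)
  also have "\<dots> = u * fps_X * (p * w)"
    by (simp add: q v algebra_simps)
  finally have "fps_deriv (fps_X * u) * v = fps_const c * (fps_X * u)"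
    by (simp add: p mult_ac)
  then show ?thesis
    using u0 by (intro that[of "fps_X * u"]) (auto simp: c_def)
qed

text \<open>If \<open>f\<close> is an eigenvector of the derivation with eigenvalue
  \<open>c\<close>, then \<open>f ^ Suc i\<close> is one with eigenvalue \<open>Suc i\<close> times
  \<open>c\<close>. On the right-hand side the same factor arises because
  \<open>vf_mat k fps_X\<close> is diagonal with entries 1, ..., \<open>k\<close>.\<close>

lemma jet_mat_conj_vf_mat:
  assumes "fps_nth v 0 = 0" "fps_deriv f * v = fps_const c * f"
  shows "jet_mat k f * vf_mat k v = (c \<cdot>\<^sub>m vf_mat k fps_X) * jet_mat k f"
proof (rule eq_matI)
  fix i l assume "i < dim_row ((c \<cdot>\<^sub>m vf_mat k fps_X) * jet_mat k f)"
    "l < dim_col ((c \<cdot>\<^sub>m vf_mat k fps_X) * jet_mat k f)"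
  then have il: "i < k" "l < k" by (auto simp: jet_mat_def vf_mat_def)
  have "fps_deriv (f ^ Suc i) * v = fps_const (of_nat (Suc i)) * f ^ i * (fps_deriv f * v)"
    by (simp add: fps_deriv_power mult_ac del: power_Suc of_nat_Suc)
  also have "\<dots> = fps_const (of_nat (Suc i) * c) * f ^ Suc i"
    unfolding assms(2) by (simp add: mult_ac flip: fps_const_mult)
  finally have "(jet_mat k f * vf_mat k v) $$ (i, l) = of_nat (Suc i) * c * fps_nth (f ^ Suc i) (Suc l)"
    using il assms(1) by (simp add: jet_mat_mult_vf_mat del: power_Suc of_nat_Suc)
  moreover have "(c \<cdot>\<^sub>m vf_mat k fps_X) $$ (i, j) = (if j = i then of_nat (Suc i) * c else 0)"
    if "j < k" for j
    using that il by (auto simp: vf_mat_index carrier_matD[OF vf_mat_carrier] simp del: of_nat_Suc)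
  then have "((c \<cdot>\<^sub>m vf_mat k fps_X) * jet_mat k f) $$ (i, l)
      = of_nat (Suc i) * c * fps_nth (f ^ Suc i) (Suc l)"
    using il by (subst index_mult_mat_sum[where k = k])
      (auto simp: jet_mat_index if_distrib[of "\<lambda>x. x * _"] cong: if_cong
        simp del: power_Suc of_nat_Suc index_smult_mat)
  ultimately show "(jet_mat k f * vf_mat k v) $$ (i, l) = ((c \<cdot>\<^sub>m vf_mat k fps_X) * jet_mat k f) $$ (i, l)"
    using il by simp
qed (auto simp: jet_mat_def vf_mat_def)

subsection \<open>Lie algebras of conjugate subgroups\<close>

lemma poly_funs_sum:
  assumes "finite S" "\<And>s. s \<in> S \<Longrightarrow> f s \<in> poly_funs k"
  shows "(\<lambda>X. \<Sum>s\<in>S. f s X) \<in> poly_funs k"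
  using assms by (induction S) (auto intro: poly_funs.intros)

lemma poly_funs_prod_list:
  assumes "\<And>l. l \<in> set s \<Longrightarrow> f l \<in> poly_funs k"
  shows "(\<lambda>X. prod_list (map (\<lambda>l. f l X) s)) \<in> poly_funs k"
  using assms by (induction s) (auto intro: poly_funs.intros)

text \<open>The entries of a two-sided product are linear in those of the middle factor. Agreement
  is claimed only on \<open>carrier_mat k k\<close>, where the double sum computes the
  product.\<close>

lemma poly_funs_compose_linear:
  assumes "g \<in> carrier_mat k k" "h \<in> carrier_mat k k" "f \<in> poly_funs k"
  obtains f' where "f' \<in> poly_funs k" "\<And>X. X \<in> carrier_mat k k \<Longrightarrow> f' X = f (g * X * h)"
proof -
  have "\<exists>f'\<in>poly_funs k. \<forall>X\<in>carrier_mat k k. f' X = f (g * X * h)"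
    using assms(3)
  proof induction
    case (const c)
    show ?case by (auto intro!: bexI[OF _ poly_funs.const[of c]])
  next
    case (entry i j)
    let ?f = "\<lambda>X. \<Sum>m<k. (\<Sum>l<k. g $$ (i, l) * X $$ (l, m)) * h $$ (m, j)"
    have "?f \<in> poly_funs k"
      using entry by (intro poly_funs_sum poly_funs.mult poly_funs.const poly_funs.entry) auto
    moreover have "?f X = (g * X * h) $$ (i, j)" if "X \<in> carrier_mat k k" for X
      using that assms entry
      by (subst index_mult_mat_sum[where k = k])
        (auto intro!: sum.cong simp: index_mult_mat_sum[where k = k] simp del: index_mult_mat)
    ultimately show ?case by (intro bexI[of _ ?f]) auto
  next
    case (add f1 f2)
    then obtain p1 p2 where "p1 \<in> poly_funs k" "p2 \<in> poly_funs k"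
      "\<forall>X\<in>carrier_mat k k. p1 X = f1 (g * X * h)" "\<forall>X\<in>carrier_mat k k. p2 X = f2 (g * X * h)"
      by blast
    then show ?case
      by (intro bexI[of _ "\<lambda>X. p1 X + p2 X"]) (auto intro: poly_funs.add)
  next
    case (mult f1 f2)
    then obtain p1 p2 where "p1 \<in> poly_funs k" "p2 \<in> poly_funs k"
      "\<forall>X\<in>carrier_mat k k. p1 X = f1 (g * X * h)" "\<forall>X\<in>carrier_mat k k. p2 X = f2 (g * X * h)"
      by blast
    then show ?case
      by (intro bexI[of _ "\<lambda>X. p1 X * p2 X"]) (auto intro: poly_funs.mult)
  qed
  then show ?thesis using that by blast
qed

lemma conj_mat_line:
  fixes g h X :: "complex mat"
  assumes "g \<in> carrier_mat k k" "h \<in> carrier_mat k k" "g * h = 1\<^sub>m k" "X \<in> carrier_mat k k"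
  shows "g * (1\<^sub>m k + z \<cdot>\<^sub>m X) * h = 1\<^sub>m k + z \<cdot>\<^sub>m (g * X * h)"
proof -
  have "g * (1\<^sub>m k + z \<cdot>\<^sub>m X) = g + z \<cdot>\<^sub>m (g * X)"
    using assms by (simp add: mult_add_distrib_mat[of _ k k _ k] mult_smult_distrib[of _ k k _ k]
      right_mult_one_mat[of _ k k])
  also have "\<dots> * h = g * h + z \<cdot>\<^sub>m (g * X * h)"
    using assms by (simp add: add_mult_distrib_mat[of _ k k _ _ k] mult_smult_assoc_mat[of _ k k _ k])
  finally show ?thesis using assms by simp
qed

lemma conj_mat_cancel:
  fixes g h X :: "complex mat"
  assumes "g \<in> carrier_mat k k" "h \<in> carrier_mat k k" "g * h = 1\<^sub>m k" "X \<in> carrier_mat k k"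
  shows "g * (h * X * g) * h = X"
proof -
  have "g * (h * X * g) * h = (g * h) * X * (g * h)"
    using assms(1,2,4) by (simp add: assoc_mult_mat[of _ k k _ k _ k])
  then show ?thesis using assms by (simp add: left_mult_one_mat[of _ k k] right_mult_one_mat[of _ k k])
qed

lemma lie_alg_carrier: "X \<in> lie_alg k S \<Longrightarrow> X \<in> carrier_mat k k"
  by (simp add: lie_alg_def)

text \<open>A polynomial vanishing on the conjugated set pulls back to one vanishing on
  \<open>S\<close>, and conjugation, being linear and fixing the identity, carries tangent lines at
  the identity to such lines.\<close>

lemma lie_alg_conj:
  assumes gh: "g \<in> carrier_mat k k" "h \<in> carrier_mat k k" "g * h = 1\<^sub>m k" "h * g = 1\<^sub>m k"
    and S: "S \<subseteq> carrier_mat k k"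
  shows "lie_alg k ((\<lambda>X. g * X * h) ` S) = (\<lambda>X. g * X * h) ` lie_alg k S"
proof -
  \<comment> \<open>One inclusion is proved for arbitrary \<open>g\<close>, \<open>h\<close>,
    \<open>S\<close>, so that exchanging \<open>g\<close> and \<open>h\<close> gives the
    other.\<close>
  have sub: "g * X * h \<in> lie_alg k ((\<lambda>X. g * X * h) ` S)"
    if gh: "g \<in> carrier_mat k k" "h \<in> carrier_mat k k" "g * h = 1\<^sub>m k"
      and S: "S \<subseteq> carrier_mat k k" and X: "X \<in> lie_alg k S" for g h S X
    unfolding lie_alg_def
  proof (intro CollectI conjI ballI impI)
    have Xc: "X \<in> carrier_mat k k" by (rule lie_alg_carrier[OF X])
    show "g * X * h \<in> carrier_mat k k" using gh Xc by simp
    fix f assume f: "f \<in> poly_funs k" "\<forall>y\<in>(\<lambda>X. g * X * h) ` S. f y = 0"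
    obtain f' where f': "f' \<in> poly_funs k" "\<And>X. X \<in> carrier_mat k k \<Longrightarrow> f' X = f (g * X * h)"
      using poly_funs_compose_linear[OF gh(1,2) f(1)] by blast
    have "\<forall>y\<in>S. f' y = 0" using f f' S by auto
    then have "((\<lambda>z. f' (1\<^sub>m k + z \<cdot>\<^sub>m X)) has_field_derivative 0) (at 0)"
      using X f'(1) by (auto simp: lie_alg_def)
    moreover have "f' (1\<^sub>m k + z \<cdot>\<^sub>m X) = f (1\<^sub>m k + z \<cdot>\<^sub>m (g * X * h))" for z
      using Xc by (subst f'(2)) (auto simp: conj_mat_line[OF gh])
    ultimately show "((\<lambda>z. f (1\<^sub>m k + z \<cdot>\<^sub>m (g * X * h))) has_field_derivative 0) (at 0)"
      by simp
  qed
  show ?thesis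
  proof (intro equalityI subsetI)
    fix Y assume Y: "Y \<in> lie_alg k ((\<lambda>X. g * X * h) ` S)"
    have "(\<lambda>X. h * X * g) ` (\<lambda>X. g * X * h) ` S = (\<lambda>X. X) ` S"
      unfolding image_image using S gh conj_mat_cancel[OF gh(2,1,4)] by (intro image_cong) auto
    moreover have "h * Y * g \<in> lie_alg k ((\<lambda>X. h * X * g) ` (\<lambda>X. g * X * h) ` S)"
      using S gh Y by (intro sub) auto
    ultimately have "h * Y * g \<in> lie_alg k S" by simp
    moreover have "Y = g * (h * Y * g) * h"
      using conj_mat_cancel[OF gh(1-3) lie_alg_carrier[OF Y]] by simp
    ultimately show "Y \<in> (\<lambda>X. g * X * h) ` lie_alg k S" by blast
  qed (use sub gh S in auto)
qed

subsection \<open>The Lie algebra of the jet group\<close>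

text \<open>A chain rule by induction on polynomials: value and derivative at 0 depend only on the
  first-order data of the curve. The product rule involves the values at 0, hence their equality is
  part of the induction. It serves to exchange a line for a curve inside the group, and, with both
  curves equal, to obtain differentiability.\<close>

lemma poly_funs_tangent_curves:
  assumes "f \<in> poly_funs k"
    and "\<And>i j. i < k \<Longrightarrow> j < k \<Longrightarrow> Y 0 $$ (i, j) = Z 0 $$ (i, j)"
    and "\<And>i j. i < k \<Longrightarrow> j < k \<Longrightarrow> ((\<lambda>z. Y z $$ (i, j)) has_field_derivative D i j) (at 0)"
    and "\<And>i j. i < k \<Longrightarrow> j < k \<Longrightarrow> ((\<lambda>z. Z z $$ (i, j)) has_field_derivative D i j) (at 0)"
  shows "f (Y 0) = f (Z 0) \<and> (\<exists>d. ((\<lambda>z. f (Y z)) has_field_derivative d) (at (0::complex)) \<and>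
    ((\<lambda>z. f (Z z)) has_field_derivative d) (at 0))"
  using assms(1)
proof induction
  case (const c)
  then show ?case by (auto intro!: exI[of _ 0])
next
  case (entry i j)
  then show ?case using assms(2-4)[of i j] by auto
next
  case (add f g)
  then obtain d e where "((\<lambda>z. f (Y z)) has_field_derivative d) (at 0)"
    "((\<lambda>z. f (Z z)) has_field_derivative d) (at 0)"
    "((\<lambda>z. g (Y z)) has_field_derivative e) (at 0)"
    "((\<lambda>z. g (Z z)) has_field_derivative e) (at 0)" by blast
  then show ?case using add.IH by (auto intro!: exI[of _ "d + e"] derivative_intros)
next
  case (mult f g)
  then obtain d e where *: "((\<lambda>z. f (Y z)) has_field_derivative d) (at 0)"
    "((\<lambda>z. f (Z z)) has_field_derivative d) (at 0)"
    "((\<lambda>z. g (Y z)) has_field_derivative e) (at 0)"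
    "((\<lambda>z. g (Z z)) has_field_derivative e) (at 0)" by blast
  show ?case
    using mult.IH DERIV_mult[OF *(1,3)] DERIV_mult[OF *(2,4)] by auto
qed

text \<open>The power rule read off coefficientwise. The induction varies \<open>m\<close> because
  the Cauchy product mixes all lower coefficients; at \<open>n = 0\<close> the truncated exponent
  \<open>n - 1\<close> is harmless, its factor being 0.\<close>

lemma fps_nth_line_power_deriv:
  fixes f v :: "'a :: real_normed_field fps"
  shows "((\<lambda>z. fps_nth ((f + fps_const z * v) ^ n) m) has_field_derivative
    fps_nth (of_nat n * f ^ (n - 1) * v) m) (at 0)"
proof (induction n arbitrary: m)
  case 0
  then show ?case by simp
next
  case (Suc n)
  let ?d = "of_nat n * f ^ (n - 1) * v"
  have 1: "((\<lambda>z. fps_nth (f + fps_const z * v) i) has_field_derivative fps_nth v i) (at 0)" for i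
    by (auto intro!: derivative_eq_intros)
  have "((\<lambda>z. \<Sum>i=0..m. fps_nth (f + fps_const z * v) i * fps_nth ((f + fps_const z * v) ^ n) (m - i))
     has_field_derivative (\<Sum>i=0..m. fps_nth v i * fps_nth (f ^ n) (m - i) + fps_nth ?d (m - i) * fps_nth f i)) (at 0)"
    by (rule DERIV_sum) (use DERIV_mult[OF 1 Suc.IH] in simp)
  also have "(\<lambda>z. \<Sum>i=0..m. fps_nth (f + fps_const z * v) i * fps_nth ((f + fps_const z * v) ^ n) (m - i))
      = (\<lambda>z. fps_nth ((f + fps_const z * v) ^ Suc n) m)"
    by (simp add: fps_mult_nth)
  also have "(\<Sum>i=0..m. fps_nth v i * fps_nth (f ^ n) (m - i) + fps_nth ?d (m - i) * fps_nth f i)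
      = fps_nth (v * f ^ n + f * ?d) m"
    by (simp add: fps_mult_nth[of v] fps_mult_nth[of f] sum.distrib mult.commute)
  also have "v * f ^ n + f * ?d = of_nat (Suc n) * f ^ (Suc n - 1) * v"
    by (cases n) (simp_all add: algebra_simps)
  finally show ?case .
qed

lemma finite_compositions: "finite (compositions i j)"
  by (rule finite_subset[OF _ natpermute_finite[of j i]]) (auto simp: compositions_def natpermute_def)

lemma jet_matrix_cong:
  assumes "\<And>l. 1 \<le> l \<Longrightarrow> l \<le> k \<Longrightarrow> a l = b l"
  shows "jet_matrix k a = jet_matrix k b"
proof -
  have "l \<le> k" if "s \<in> compositions (Suc i) (Suc j)" "j < k" "l \<in> set s" for s i j l
    using that member_le_sum_list[of l s] by (auto simp: compositions_def)
  then show ?thesis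
    using assms unfolding jet_matrix_def
    by (intro cong_mat refl) (auto intro!: sum.cong arg_cong[where f = prod_list] simp: compositions_def)
qed

text \<open>Identifies \<open>vf_mat k v\<close> as the velocity at the identity of the curve of
  jets t + z v(t), the link between vector fields and tangent vectors.\<close>

lemma jet_mat_line_deriv:
  assumes "i < k" "j < k"
  shows "((\<lambda>z. jet_mat k (fps_X + fps_const z * v) $$ (i, j)) has_field_derivative
    vf_mat k v $$ (i, j)) (at 0)"
  using fps_nth_line_power_deriv[of fps_X v "Suc i" "Suc j"] assms
  by (simp add: jet_mat_index vf_mat_index_conv fps_deriv_power fps_of_nat del: power_Suc of_nat_Suc)

text \<open>The polynomial equations expressing each entry through the first row bound the tangent
  space from above; curves in the group through the identity bound it from below.\<close>

lemma jet_algebra_eq: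
  assumes "k \<ge> 1"
  shows "jet_algebra k = {vf_mat k v | v. fps_nth v 0 = 0}"
proof (intro equalityI subsetI)
  fix X assume "X \<in> jet_algebra k"
  then have X: "X \<in> carrier_mat k k"
    and d0: "\<And>f. f \<in> poly_funs k \<Longrightarrow> (\<And>g. g \<in> carrier (jet_group k) \<Longrightarrow> f g = 0) \<Longrightarrow>
     ((\<lambda>z. f (1\<^sub>m k + z \<cdot>\<^sub>m X)) has_field_derivative 0) (at 0)"
    by (auto simp: jet_algebra_def lie_alg_def)
  \<comment> \<open>The only candidate: row 0 of \<open>vf_mat k v\<close> lists the coefficients of
    \<open>v\<close> from degree 1 on.\<close>
  define v where "v = Abs_fps (\<lambda>n. if n = 0 then 0 else X $$ (0, n - 1))"
  have "X = vf_mat k v"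
  proof (rule eq_matI)
    fix i j assume "i < dim_row (vf_mat k v)" "j < dim_col (vf_mat k v)"
    then have ij: "i < k" "j < k" by (auto simp: vf_mat_def)
    \<comment> \<open>On the jet group every entry is a polynomial in the entries of the first row.\<close>
    define f where "f = (\<lambda>Y::complex mat. Y $$ (i, j) + (- 1) * jet_matrix k (\<lambda>l. Y $$ (0, l - 1)) $$ (i, j))"
    have "f \<in> poly_funs k"
    proof -
      have "l - Suc 0 < k" if "s \<in> compositions (Suc i) (Suc j)" "l \<in> set s" for s l
        using that ij member_le_sum_list[of l s] by (auto simp: compositions_def)
      then have "(\<lambda>Y. Y $$ (i, j) + (- 1) * (\<Sum>s\<in>compositions (Suc i) (Suc j).
          prod_list (map (\<lambda>l. Y $$ (0, l - 1)) s))) \<in> poly_funs k"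
        using ij assms by (intro poly_funs.add poly_funs.mult poly_funs.entry poly_funs.const
          poly_funs_sum finite_compositions poly_funs_prod_list) auto
      then show ?thesis using ij by (simp add: f_def jet_matrix_def)
    qed
    moreover have "f g = 0" if g: "g \<in> carrier (jet_group k)" for g
    proof -
      obtain a where a: "g = jet_matrix k a" using g by (auto simp: jet_group_def)
      have "g $$ (0, l - 1) = a l" if "1 \<le> l" "l \<le> k" for l
      proof -
        have "compositions 1 l = {[l]}"
          using that by (auto simp: compositions_def length_Suc_conv)
        then show ?thesis using that by (simp add: a jet_matrix_def)
      qed
      then have "jet_matrix k (\<lambda>l. g $$ (0, l - 1)) = g"
        unfolding a by (intro jet_matrix_cong) auto
      then show ?thesis by (simp add: f_def)
    qed
    ultimately have "((\<lambda>z. f (1\<^sub>m k + z \<cdot>\<^sub>m X)) has_field_derivative 0) (at 0)"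
      by (rule d0)
    \<comment> \<open>The first row of \<open>1\<^sub>m k + z \<cdot>\<^sub>m X\<close> is that of
      the jet t + z v(t), so \<open>f\<close> measures how far the line departs from this curve in
      entry \<open>(i, j)\<close>.\<close>
    moreover have "f (1\<^sub>m k + z \<cdot>\<^sub>m X) = (1\<^sub>m k + z \<cdot>\<^sub>m X) $$ (i, j)
        - jet_mat k (fps_X + fps_const z * v) $$ (i, j)" for z
    proof -
      have "jet_matrix k (\<lambda>l. (1\<^sub>m k + z \<cdot>\<^sub>m X) $$ (0, l - 1)) = jet_matrix k (fps_nth (fps_X + fps_const z * v))"
        using X by (intro jet_matrix_cong) (auto simp: v_def)
      moreover have "Abs_fps (\<lambda>n. if n = 0 then 0 else fps_nth (fps_X + fps_const z * v) n)
          = fps_X + fps_const z * v"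
        by (auto simp: fps_eq_iff v_def)
      ultimately show ?thesis by (simp only: f_def jet_matrix_eq_jet_mat) simp
    qed
    ultimately have "((\<lambda>z. (1\<^sub>m k + z \<cdot>\<^sub>m X) $$ (i, j)
        - jet_mat k (fps_X + fps_const z * v) $$ (i, j)) has_field_derivative 0) (at 0)"
      by simp
    moreover have "((\<lambda>z. (1\<^sub>m k + z \<cdot>\<^sub>m X) $$ (i, j)
        - jet_mat k (fps_X + fps_const z * v) $$ (i, j)) has_field_derivative X $$ (i, j) - vf_mat k v $$ (i, j)) (at 0)"
      using ij X by (intro DERIV_diff jet_mat_line_deriv) (auto intro!: derivative_eq_intros)
    ultimately have "X $$ (i, j) - vf_mat k v $$ (i, j) = 0"
      by (rule DERIV_unique[THEN sym])
    then show "X $$ (i, j) = vf_mat k v $$ (i, j)" by simp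
  qed (use X in \<open>auto simp: vf_mat_def\<close>)
  moreover have "fps_nth v 0 = 0" by (simp add: v_def)
  ultimately show "X \<in> {vf_mat k v | v. fps_nth v 0 = 0}" by blast
next
  fix X assume "X \<in> {vf_mat k v | v. fps_nth v 0 = 0}"
  then obtain v where v: "fps_nth v 0 = 0" and X: "X = vf_mat k v" by blast
  have "((\<lambda>z. f (1\<^sub>m k + z \<cdot>\<^sub>m X)) has_field_derivative 0) (at 0)"
    if f: "f \<in> poly_funs k" "\<forall>g\<in>carrier (jet_group k). f g = 0" for f
  proof -
    let ?J = "\<lambda>z. jet_mat k (fps_X + fps_const z * v)"
    \<comment> \<open>The line and the curve of jets agree to first order at the identity, so
      \<open>f\<close> has the same derivative along both.\<close>
    have "\<exists>d. ((\<lambda>z. f (1\<^sub>m k + z \<cdot>\<^sub>m X)) has_field_derivative d) (at 0) \<and>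
        ((\<lambda>z. f (?J z)) has_field_derivative d) (at 0)"
      by (rule conjunct2[OF poly_funs_tangent_curves[OF f(1), where D = "\<lambda>i j. X $$ (i, j)"]])
        (auto simp: X jet_mat_X jet_mat_line_deriv carrier_matD[OF vf_mat_carrier]
          intro!: derivative_eq_intros)
    then obtain d where d: "((\<lambda>z. f (1\<^sub>m k + z \<cdot>\<^sub>m X)) has_field_derivative d) (at 0)"
        "((\<lambda>z. f (?J z)) has_field_derivative d) (at 0)" by blast
    \<comment> \<open>For small \<open>z\<close> the linear coefficient stays nonzero, so the curve
      remains in the group, where \<open>f\<close> vanishes.\<close>
    have "open {z. 1 + z * fps_nth v 1 \<noteq> 0}"
      by (intro open_Collect_neq continuous_intros)
    then have "\<forall>\<^sub>F z in nhds 0. 1 + z * fps_nth v 1 \<noteq> 0"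
      by (auto simp: eventually_nhds)
    then have "\<forall>\<^sub>F z in nhds 0. f (?J z) = 0"
    proof (rule eventually_mono)
      fix z assume "1 + z * fps_nth v 1 \<noteq> 0"
      then have "?J z \<in> carrier (jet_group k)"
        unfolding carrier_jet_group using v by (auto intro!: exI[of _ "fps_X + fps_const z * v"])
      then show "f (?J z) = 0" using f(2) by blast
    qed
    then have "((\<lambda>z. f (?J z)) has_field_derivative 0) (at 0)"
      by (subst DERIV_cong_ev[OF refl _ refl]) auto
    with d show ?thesis using DERIV_unique by blast
  qed
  then show "X \<in> jet_algebra k"
    by (auto simp: jet_algebra_def lie_alg_def X)
qed

subsection \<open>Conjugacy of the generic stabilizers\<close>

lemma Ad_fixed_iff:
  assumes "g \<in> carrier (jet_group k)" "X \<in> carrier_mat k k"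
  shows "Ad (jet_group k) g X = X \<longleftrightarrow> g * X = X * g"
proof -
  let ?h = "inv\<^bsub>jet_group k\<^esub> g"
  note g = jet_group_invD[OF assms(1)]
  have cancel: "A * g * ?h = A" "A * ?h * g = A" if "A \<in> carrier_mat k k" for A
    using that g(1,2) by (simp_all add: assoc_mult_mat[of _ k k _ k _ k] g(4,5) right_mult_one_mat[of _ k k])
  have "g * X * ?h = X \<longleftrightarrow> g * X = X * g"
    using cancel(1)[OF assms(2)] cancel(2)[of "g * X"] g(1) assms(2) by auto
  then show ?thesis by (simp add: Ad_def)
qed

lemma stabilizer_Ad:
  assumes "X \<in> carrier_mat k k"
  shows "stabilizer (jet_group k) (Ad (jet_group k)) X = {g \<in> carrier (jet_group k). g * X = X * g}"
  using Ad_fixed_iff[OF _ assms] by (auto simp: stabilizer_def)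

lemma Ad_mult:
  assumes "g \<in> carrier (jet_group k)" "h \<in> carrier (jet_group k)" "X \<in> carrier_mat k k"
  shows "Ad (jet_group k) (g * h) X = Ad (jet_group k) g (Ad (jet_group k) h X)"
proof -
  interpret group "jet_group k" by (rule jet_group_group)
  have "inv\<^bsub>jet_group k\<^esub> (g * h) = inv\<^bsub>jet_group k\<^esub> h * inv\<^bsub>jet_group k\<^esub> g"
    using inv_mult_group[OF assms(1,2)] by (simp add: jet_group_def)
  then show ?thesis
    using assms jet_group_invD[OF assms(1)] jet_group_invD[OF assms(2)]
    by (simp add: Ad_def assoc_mult_mat[of _ k k _ k _ k])
qed

lemma Ad_Ad_inv:
  assumes "g \<in> carrier (jet_group k)" "X \<in> carrier_mat k k"
  shows "Ad (jet_group k) g (Ad (jet_group k) (inv\<^bsub>jet_group k\<^esub> g) X) = X"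
    and "Ad (jet_group k) (inv\<^bsub>jet_group k\<^esub> g) (Ad (jet_group k) g X) = X"
proof -
  interpret group "jet_group k" by (rule jet_group_group)
  note g = jet_group_invD[OF assms(1)]
  show "Ad (jet_group k) g (Ad (jet_group k) (inv\<^bsub>jet_group k\<^esub> g) X) = X"
    "Ad (jet_group k) (inv\<^bsub>jet_group k\<^esub> g) (Ad (jet_group k) g X) = X"
    using conj_mat_cancel[OF g(1,2,4) assms(2)] conj_mat_cancel[OF g(2,1,5) assms(2)] assms(1)
    by (simp_all add: Ad_def)
qed

lemma Ad_carrier:
  "g \<in> carrier (jet_group k) \<Longrightarrow> X \<in> carrier_mat k k \<Longrightarrow> Ad (jet_group k) g X \<in> carrier_mat k k"
  using jet_group_invD[of g k] by (auto simp: Ad_def)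

lemma Ad_times:
  assumes "g \<in> carrier (jet_group k)" "X \<in> carrier_mat k k" "Y \<in> carrier_mat k k"
  shows "Ad (jet_group k) g (X * Y) = Ad (jet_group k) g X * Ad (jet_group k) g Y"
proof -
  let ?h = "inv\<^bsub>jet_group k\<^esub> g"
  note g = jet_group_invD[OF assms(1)]
  have "(g * X * ?h) * (g * Y * ?h) = g * X * (?h * g) * Y * ?h"
    using g(1,2) assms(2,3) by (simp add: assoc_mult_mat[of _ k k _ k _ k])
  then show ?thesis
    using g assms(2,3)
    by (simp add: Ad_def assoc_mult_mat[of _ k k _ k _ k] left_mult_one_mat[of _ k k])
qed

lemma Ad_minus:
  assumes "g \<in> carrier (jet_group k)" "X \<in> carrier_mat k k" "Y \<in> carrier_mat k k"
  shows "Ad (jet_group k) g (X - Y) = Ad (jet_group k) g X - Ad (jet_group k) g Y"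
  using jet_group_invD[OF assms(1)] assms(2,3)
  by (simp add: Ad_def mult_minus_distrib_mat[of _ k k _ k] minus_mult_distrib_mat[of _ k k _ _ k])

lemma Ad_lie_bracket:
  assumes "g \<in> carrier (jet_group k)" "X \<in> carrier_mat k k" "Y \<in> carrier_mat k k"
  shows "Ad (jet_group k) g (lie_bracket X Y) = lie_bracket (Ad (jet_group k) g X) (Ad (jet_group k) g Y)"
  using assms by (simp add: lie_bracket_def Ad_minus[of g k] Ad_times[of g k])

lemma Ad_zero:
  assumes "g \<in> carrier (jet_group k)"
  shows "Ad (jet_group k) g (0\<^sub>m k k) = 0\<^sub>m k k"
  using jet_group_invD[OF assms] by (simp add: Ad_def)

text \<open>This absorbs the eigenvalue left over by linearization: commuting with a matrix and with
  a nonzero multiple of it are equivalent.\<close>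

lemma stabilizer_smult:
  assumes "X \<in> carrier_mat k k" "c \<noteq> 0"
  shows "stabilizer (jet_group k) (Ad (jet_group k)) (c \<cdot>\<^sub>m X) = stabilizer (jet_group k) (Ad (jet_group k)) X"
proof -
  have "g * (c \<cdot>\<^sub>m X) = (c \<cdot>\<^sub>m X) * g \<longleftrightarrow> g * X = X * g" if "g \<in> carrier (jet_group k)" for g
  proof -
    have "g * (c \<cdot>\<^sub>m X) = c \<cdot>\<^sub>m (g * X)" "(c \<cdot>\<^sub>m X) * g = c \<cdot>\<^sub>m (X * g)"
      using jet_group_invD(1)[OF that] assms(1)
      by (simp_all add: mult_smult_distrib[of _ k k _ k] mult_smult_assoc_mat[of _ k k _ k])
    moreover have "c \<cdot>\<^sub>m A = c \<cdot>\<^sub>m B \<Longrightarrow> A = B" for A B :: "complex mat"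
      using assms(2) by (auto simp: mat_eq_iff)
    ultimately show ?thesis by auto
  qed
  then show ?thesis
    using assms(1) by (auto simp: stabilizer_Ad)
qed

lemma stabilizer_Ad_conj:
  assumes "h \<in> carrier (jet_group k)" "X \<in> carrier_mat k k"
  shows "stabilizer (jet_group k) (Ad (jet_group k)) (Ad (jet_group k) h X)
      = Ad (jet_group k) h ` stabilizer (jet_group k) (Ad (jet_group k)) X"
proof -
  interpret group "jet_group k" by (rule jet_group_group)
  \<comment> \<open>Stated for all \<open>h\<close> and \<open>X\<close>, so that the inverse of
    \<open>h\<close> yields the reverse inclusion.\<close>
  have sub: "Ad (jet_group k) h s \<in> stabilizer (jet_group k) (Ad (jet_group k)) (Ad (jet_group k) h X)"
    if h: "h \<in> carrier (jet_group k)" and X: "X \<in> carrier_mat k k"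
      and s: "s \<in> stabilizer (jet_group k) (Ad (jet_group k)) X" for h X s
  proof -
    have s: "s \<in> carrier (jet_group k)" "s * X = X * s"
      using s X by (auto simp: stabilizer_Ad)
    have "h \<otimes>\<^bsub>jet_group k\<^esub> s \<otimes>\<^bsub>jet_group k\<^esub> inv\<^bsub>jet_group k\<^esub> h \<in> carrier (jet_group k)"
      using h s by blast
    then have "Ad (jet_group k) h s \<in> carrier (jet_group k)"
      by (simp add: Ad_def jet_group_def)
    moreover have "Ad (jet_group k) h s * Ad (jet_group k) h X = Ad (jet_group k) h X * Ad (jet_group k) h s"
      using h s X jet_group_invD(1)[OF s(1)] by (simp flip: Ad_times)
    ultimately show ?thesis
      using h X by (simp add: stabilizer_Ad Ad_carrier)
  qed
  show ?thesis
  proof (intro equalityI subsetI)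
    fix s assume s: "s \<in> stabilizer (jet_group k) (Ad (jet_group k)) (Ad (jet_group k) h X)"
    then have "s \<in> carrier_mat k k"
      using jet_group_invD(1) by (auto simp: stabilizer_def)
    moreover have "Ad (jet_group k) (inv\<^bsub>jet_group k\<^esub> h) s \<in> stabilizer (jet_group k) (Ad (jet_group k)) X"
      using sub[of "inv\<^bsub>jet_group k\<^esub> h" "Ad (jet_group k) h X" s] assms s
      by (simp add: Ad_carrier Ad_Ad_inv)
    ultimately show "s \<in> Ad (jet_group k) h ` stabilizer (jet_group k) (Ad (jet_group k)) X"
      using assms by (intro image_eqI[of _ _ "Ad (jet_group k) (inv\<^bsub>jet_group k\<^esub> h) s"]) (auto simp: Ad_Ad_inv)
  qed (use sub assms in auto)
qed

lemma lie_alg_stabilizer_conj: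
  assumes "h \<in> carrier (jet_group k)" "X \<in> carrier_mat k k"
  shows "lie_alg k (stabilizer (jet_group k) (Ad (jet_group k)) (Ad (jet_group k) h X))
      = Ad (jet_group k) h ` lie_alg k (stabilizer (jet_group k) (Ad (jet_group k)) X)"
proof -
  have "stabilizer (jet_group k) (Ad (jet_group k)) X \<subseteq> carrier_mat k k"
    using jet_group_invD(1) by (auto simp: stabilizer_def)
  from lie_alg_conj[OF jet_group_invD(1,2,4,5)[OF assms(1)] this] show ?thesis
    unfolding stabilizer_Ad_conj[OF assms] by (simp add: Ad_def[abs_def])
qed

section \<open>Linearization in the Lie algebra and conjugacy of stabilizers\<close>

lemma jet_algebra_carrier: "X \<in> jet_algebra k \<Longrightarrow> X \<in> carrier_mat k k"
  by (simp add: jet_algebra_def lie_alg_carrier)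

lemma vf_mat_00: "k \<ge> 1 \<Longrightarrow> fps_nth v 0 = 0 \<Longrightarrow> vf_mat k v $$ (0, 0) = fps_nth v 1"
  by (subst vf_mat_index) auto

text \<open>The entry \<open>(0, 0)\<close> is the linear coefficient of the vector field, so its
  being nonzero is what \<open>linearizing_jet\<close> requires; the matrix of the resulting jet is
  the conjugating element.\<close>

lemma jet_algebra_linearize:
  assumes "k \<ge> 1" "X \<in> jet_algebra k" "X $$ (0, 0) \<noteq> 0"
  obtains g where "g \<in> carrier (jet_group k)"
    "Ad (jet_group k) g X = X $$ (0, 0) \<cdot>\<^sub>m vf_mat k fps_X"
proof -
  obtain v where v: "X = vf_mat k v" "fps_nth v 0 = 0"
    using assms jet_algebra_eq by auto
  have v1: "fps_nth v 1 = X $$ (0, 0)"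
    using v assms(1) by (simp add: vf_mat_00)
  with assms(3) v obtain f where f: "fps_nth f 0 = 0" "fps_nth f 1 \<noteq> 0"
    "fps_deriv f * v = fps_const (X $$ (0, 0)) * f"
    using linearizing_jet[of v] by auto
  define g where "g = jet_mat k f"
  have g: "g \<in> carrier (jet_group k)" using f by (auto simp: carrier_jet_group g_def)
  let ?E = "X $$ (0, 0) \<cdot>\<^sub>m vf_mat k fps_X"
  have "g * X = ?E * g"
    unfolding g_def v(1) using jet_mat_conj_vf_mat[OF v(2) f(3)] by (simp add: v(1))
  then have "Ad (jet_group k) g X = ?E * (g * inv\<^bsub>jet_group k\<^esub> g)"
    using jet_group_invD(1,2)[OF g] by (simp add: Ad_def assoc_mult_mat[of _ k k _ k _ k])
  also have "\<dots> = ?E"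
    using jet_group_invD(4)[OF g] by (simp add: right_mult_one_mat[of _ k k])
  finally show ?thesis using g that by blast
qed

text \<open>Both elements are carried to nonzero multiples of the same diagonal matrix, which share
  a stabilizer. The conjugating element goes forward by \<open>g\<close> and back by the inverse of
  \<open>h\<close>.\<close>

lemma lie_alg_stabilizers_conjugate:
  assumes "k \<ge> 1" and X: "X \<in> jet_algebra k" "X $$ (0, 0) \<noteq> 0"
    and Y: "Y \<in> jet_algebra k" "Y $$ (0, 0) \<noteq> 0"
  shows "\<exists>g\<in>carrier (jet_group k). lie_alg k (stabilizer (jet_group k) (Ad (jet_group k)) Y)
    = Ad (jet_group k) g ` lie_alg k (stabilizer (jet_group k) (Ad (jet_group k)) X)"
proof -
  let ?L = "\<lambda>X. lie_alg k (stabilizer (jet_group k) (Ad (jet_group k)) X)"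
  interpret group "jet_group k" by (rule jet_group_group)
  obtain g where g: "g \<in> carrier (jet_group k)"
    "Ad (jet_group k) g X = X $$ (0, 0) \<cdot>\<^sub>m vf_mat k fps_X"
    using jet_algebra_linearize[OF assms(1) X] .
  obtain h where h: "h \<in> carrier (jet_group k)"
    "Ad (jet_group k) h Y = Y $$ (0, 0) \<cdot>\<^sub>m vf_mat k fps_X"
    using jet_algebra_linearize[OF assms(1) Y] .
  let ?h' = "inv\<^bsub>jet_group k\<^esub> h"
  have eq: "Ad (jet_group k) h ` ?L Y = Ad (jet_group k) g ` ?L X"
    using lie_alg_stabilizer_conj[OF g(1) jet_algebra_carrier[OF X(1)]]
      lie_alg_stabilizer_conj[OF h(1) jet_algebra_carrier[OF Y(1)]] X Y
    by (simp add: g(2) h(2) stabilizer_smult)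
  have "?L Y = Ad (jet_group k) ?h' ` Ad (jet_group k) h ` ?L Y"
    using h(1) lie_alg_carrier by (force simp: image_image Ad_Ad_inv)
  also have "\<dots> = Ad (jet_group k) (?h' * g) ` ?L X"
    unfolding eq image_image using g h lie_alg_carrier
    by (intro image_cong refl) (simp add: Ad_mult)
  finally have "?L Y = Ad (jet_group k) (?h' * g) ` ?L X" .
  moreover have "?h' \<otimes>\<^bsub>jet_group k\<^esub> g \<in> carrier (jet_group k)"
    using g h by simp
  ultimately show ?thesis by (auto simp: jet_group_def)
qed

section \<open>The Zariski topology and density of the generic locus\<close>

lemma zariski_topspace: "topspace (zariski k) = carrier_mat k k"
proof -
  have "carrier_mat k k \<in> {{X \<in> carrier_mat k k. f X \<noteq> 0} | f. f \<in> poly_funs k}"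
    by (auto intro!: exI[of _ "\<lambda>X. 1"] poly_funs.const)
  then show ?thesis unfolding zariski_def topology_generated_by_topspace by blast
qed

text \<open>The generating sets are already a base: a product of two polynomials is nonzero exactly
  where both factors are.\<close>

lemma zariski_principal_nbhd:
  assumes "openin (zariski k) W" "X \<in> W"
  obtains f where "f \<in> poly_funs k" "f X \<noteq> 0" "{Y \<in> carrier_mat k k. f Y \<noteq> 0} \<subseteq> W"
proof -
  have "\<exists>f\<in>poly_funs k. f X \<noteq> 0 \<and> {Y \<in> carrier_mat k k. f Y \<noteq> 0} \<subseteq> W"
    using assms unfolding zariski_def openin_topology_generated_by_iff
  proof (induction arbitrary: X)
    case (Int a b)
    then obtain f g where "f \<in> poly_funs k" "f X \<noteq> 0" "{Y \<in> carrier_mat k k. f Y \<noteq> 0} \<subseteq> a"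
      "g \<in> poly_funs k" "g X \<noteq> 0" "{Y \<in> carrier_mat k k. g Y \<noteq> 0} \<subseteq> b"
      by blast
    then show ?case by (intro bexI[of _ "\<lambda>Y. f Y * g Y"]) (auto intro: poly_funs.mult)
  next
    case (UN K)
    then obtain V where "V \<in> K" "X \<in> V" by blast
    with UN.IH[OF this] show ?case by blast
  qed auto
  then show ?thesis using that by blast
qed

lemma vf_mat_add_smult:
  "vf_mat k v + z \<cdot>\<^sub>m vf_mat k w = vf_mat k (v + fps_const z * w)"
  by (rule eq_matI) (auto simp: vf_mat_def distrib_left mult.left_commute[of _ "fps_const z"]
    simp del: power_Suc)

lemma has_generic_stabilizer_Ad:
  assumes k: "k \<ge> 1"
  shows "has_generic_stabilizer k (jet_group k) (Ad (jet_group k))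
    (subtopology (zariski k) (jet_algebra k))"
proof -
  define T where "T = subtopology (zariski k) (jet_algebra k)"
  define U where "U = {X \<in> jet_algebra k. X $$ (0, 0) \<noteq> 0}"
  have top: "topspace T = jet_algebra k"
    using jet_algebra_carrier by (auto simp: T_def zariski_topspace)
  have "openin (zariski k) {X \<in> carrier_mat k k. X $$ (0, 0) \<noteq> 0}"
    unfolding zariski_def openin_topology_generated_by_iff using k
    by (intro generate_topology_on.Basis) (auto intro!: exI[of _ "\<lambda>X. X $$ (0, 0)"] poly_funs.entry)
  moreover have "U = {X \<in> carrier_mat k k. X $$ (0, 0) \<noteq> 0} \<inter> jet_algebra k"
    using jet_algebra_carrier by (auto simp: U_def)
  ultimately have "openin T U" by (auto simp: T_def openin_subtopology)
  moreover have "T closure_of U = topspace T"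
  proof (intro equalityI subsetI closure_of_subset_topspace[THEN subsetD])
    fix X assume "X \<in> topspace T"
    then have X: "X \<in> jet_algebra k" by (simp add: top)
    have "\<exists>Y. Y \<in> U \<and> Y \<in> V" if V: "X \<in> V" "openin T V" for V
    proof -
      obtain W where W: "openin (zariski k) W" "V = W \<inter> jet_algebra k"
        using V by (auto simp: T_def openin_subtopology)
      obtain f where f: "f \<in> poly_funs k" "f X \<noteq> 0" "{Y \<in> carrier_mat k k. f Y \<noteq> 0} \<subseteq> W"
        using zariski_principal_nbhd[OF W(1)] V W(2) by blast
      \<comment> \<open>Adding \<open>z\<close> times \<open>E\<close> changes entry
        \<open>(0, 0)\<close> by \<open>z\<close>. Along this line \<open>f\<close> is continuous
        and nonzero at 0, so a suitable small \<open>z\<close> leads into \<open>U\<close> without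
        leaving \<open>V\<close>.\<close>
      define E where "E = vf_mat k fps_X"
      have E: "E \<in> carrier_mat k k" by (simp add: E_def)
      have Xc: "X \<in> carrier_mat k k" using X by (rule jet_algebra_carrier)
      have "((\<lambda>z. (X + z \<cdot>\<^sub>m E) $$ (i, j)) has_field_derivative E $$ (i, j)) (at 0)"
        if "i < k" "j < k" for i j
        using that Xc E by (auto intro!: derivative_eq_intros)
      then have "\<exists>d. ((\<lambda>z. f (X + z \<cdot>\<^sub>m E)) has_field_derivative d) (at 0)"
        using poly_funs_tangent_curves[OF f(1), of "\<lambda>z. X + z \<cdot>\<^sub>m E" "\<lambda>z. X + z \<cdot>\<^sub>m E" "\<lambda>i j. E $$ (i, j)"]
        by blast
      then have "isCont (\<lambda>z. f (X + z \<cdot>\<^sub>m E)) 0" by (auto intro: DERIV_isCont)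
      moreover have "X + 0 \<cdot>\<^sub>m E = X"
        using Xc E by (intro eq_matI) auto
      ultimately have "((\<lambda>z. f (X + z \<cdot>\<^sub>m E)) \<longlongrightarrow> f X) (at 0)"
        by (simp add: isCont_def)
      then have "\<forall>\<^sub>F z in at 0. f (X + z \<cdot>\<^sub>m E) \<noteq> 0"
        using f(2) by (rule tendsto_imp_eventually_ne)
      moreover have "\<forall>\<^sub>F z in at 0. z \<noteq> - (X $$ (0, 0))"
        by (rule eventually_neq_at_within)
      ultimately have "\<forall>\<^sub>F z in at 0. f (X + z \<cdot>\<^sub>m E) \<noteq> 0 \<and> z \<noteq> - (X $$ (0, 0))"
        by (rule eventually_conj)
      then obtain z where z: "f (X + z \<cdot>\<^sub>m E) \<noteq> 0" "z \<noteq> - (X $$ (0, 0))"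
        using eventually_happens'[OF at_neq_bot] by blast
      have "X + z \<cdot>\<^sub>m E \<in> jet_algebra k"
        using X k by (auto simp: jet_algebra_eq E_def vf_mat_add_smult)
      moreover have "(X + z \<cdot>\<^sub>m E) $$ (0, 0) \<noteq> 0"
        using z(2) k Xc by (auto simp: E_def vf_mat_00 add_eq_0_iff2 carrier_matD[OF vf_mat_carrier])
      ultimately show ?thesis
        using z(1) f(3) W(2) Xc E by (auto simp: U_def intro!: exI[of _ "X + z \<cdot>\<^sub>m E"])
    qed
    then show "X \<in> T closure_of U"
      using X by (auto simp: in_closure_of top)
  qed
  moreover have "\<forall>X\<in>U. \<forall>Y\<in>U. \<exists>g\<in>carrier (jet_group k).
      lie_alg k (stabilizer (jet_group k) (Ad (jet_group k)) Y)
    = Ad (jet_group k) g ` lie_alg k (stabilizer (jet_group k) (Ad (jet_group k)) X)"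
    using lie_alg_stabilizers_conjugate[OF k] by (auto simp: U_def)
  ultimately show ?thesis
    unfolding has_generic_stabilizer_def T_def by blast
qed

subsection \<open>Cartan subalgebras\<close>

text \<open>Coefficient rows are multiplied from the right, so the product applies the derivation
  \<open>v\<close> first and \<open>w\<close> second. The sign is therefore opposite to that of the
  usual bracket of vector fields.\<close>

lemma lie_bracket_vf_mat:
  assumes "fps_nth v 0 = 0" "fps_nth w 0 = 0"
  shows "lie_bracket (vf_mat k v) (vf_mat k w) = vf_mat k (fps_deriv v * w - v * fps_deriv w)"
proof (rule eq_matI)
  fix i l assume "i < dim_row (vf_mat k (fps_deriv v * w - v * fps_deriv w))"
    "l < dim_col (vf_mat k (fps_deriv v * w - v * fps_deriv w))"
  then have il: "i < k" "l < k" by (auto simp: vf_mat_def)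
  have mult: "(vf_mat k v * vf_mat k w) $$ (i, l)
      = fps_nth (fps_deriv (fps_deriv (fps_X ^ Suc i) * v) * w) (Suc l)"
    if "fps_nth w 0 = 0" for v w
    using il that by (subst index_mult_mat_sum[where k = k])
      (auto simp: vf_mat_index_conv[of i] sum_coeff_vf_mat simp del: power_Suc)
  have "lie_bracket (vf_mat k v) (vf_mat k w) $$ (i, l)
      = fps_nth (fps_deriv (fps_deriv (fps_X ^ Suc i) * v) * w
        - fps_deriv (fps_deriv (fps_X ^ Suc i) * w) * v) (Suc l)"
    using il assms by (simp add: lie_bracket_def mult carrier_matD[OF vf_mat_carrier] del: index_mult_mat(1) power_Suc)
  \<comment> \<open>The terms with the second derivative of \<open>fps_X ^ Suc i\<close>
    cancel.\<close>
  also have "fps_deriv (fps_deriv (fps_X ^ Suc i) * v) * w - fps_deriv (fps_deriv (fps_X ^ Suc i) * w) * v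
      = fps_deriv (fps_X ^ Suc i) * (fps_deriv v * w - v * fps_deriv w)"
    by (simp add: algebra_simps del: power_Suc)
  finally show "lie_bracket (vf_mat k v) (vf_mat k w) $$ (i, l)
      = vf_mat k (fps_deriv v * w - v * fps_deriv w) $$ (i, l)"
    using il by (simp add: vf_mat_index_conv del: power_Suc)
qed (auto simp: lie_bracket_def carrier_matD[OF vf_mat_carrier])

lemma fps_mult_nth_eq_0:
  fixes f g :: "'a :: semiring_0 fps"
  assumes "\<And>i. i < a \<Longrightarrow> fps_nth f i = 0" "\<And>i. i < b \<Longrightarrow> fps_nth g i = 0" "n < a + b"
  shows "fps_nth (f * g) n = 0"
  unfolding fps_mult_nth
proof (rule sum.neutral, rule ballI)
  fix i assume "i \<in> {0..n}"
  then have "i < a \<or> n - i < b" using assms(3) by auto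
  then show "fps_nth f i * fps_nth g (n - i) = 0" using assms(1,2) by auto
qed

text \<open>Otherwise bracketing with the subalgebra raises the order of vanishing. In the
  filtration by this order, an element just outside the subalgebra then normalizes it.\<close>

lemma cartan_subalgebra_not_nilradical:
  assumes k: "k \<ge> 1" and \<hh>: "cartan_subalgebra k (jet_algebra k) \<hh>"
  shows "\<exists>X\<in>\<hh>. X $$ (0, 0) \<noteq> 0"
proof (rule ccontr)
  assume "\<not> (\<exists>X\<in>\<hh>. X $$ (0, 0) \<noteq> 0)"
  then have nil: "X $$ (0, 0) = 0" if "X \<in> \<hh>" for X using that by blast
  have \<hh>_sub: "\<hh> \<subseteq> jet_algebra k" "0\<^sub>m k k \<in> \<hh>" and norm: "lie_normalizer (jet_algebra k) \<hh> = \<hh>"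
    using \<hh> by (auto simp: cartan_subalgebra_def lie_subalgebra_def mat_subspace_def)
  \<comment> \<open>\<open>F m\<close> consists of the fields vanishing to order greater than
    \<open>m\<close>: \<open>F 0\<close> is the whole algebra and \<open>F k\<close> is
    zero.\<close>
  define F where "F m = {vf_mat k v | v. \<forall>i\<le>m. fps_nth v i = 0}" for m
  have "F k \<subseteq> \<hh>"
  proof
    fix X assume "X \<in> F k"
    then have "X = 0\<^sub>m k k"
      by (auto simp: F_def vf_mat_index carrier_matD[OF vf_mat_carrier] intro!: eq_matI)
    then show "X \<in> \<hh>" using \<hh>_sub by simp
  qed
  moreover have "\<not> F 0 \<subseteq> \<hh>"
  proof
    assume "F 0 \<subseteq> \<hh>"
    moreover have "vf_mat k fps_X \<in> F 0" by (auto simp: F_def intro!: exI[of _ fps_X])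
    ultimately have "vf_mat k fps_X \<in> \<hh>" by blast
    from nil[OF this] show False using vf_mat_00[OF k, of fps_X] by simp
  qed
  \<comment> \<open>\<open>Suc m\<close> is the first level of the filtration contained in the
    subalgebra.\<close>
  ultimately obtain m where m: "\<not> F m \<subseteq> \<hh>" "F (Suc m) \<subseteq> \<hh>"
    using ex_least_nat_less[of "\<lambda>m. F m \<subseteq> \<hh>" k] by blast
  then obtain v where v: "\<And>i. i \<le> m \<Longrightarrow> fps_nth v i = 0" "vf_mat k v \<notin> \<hh>"
    by (auto simp: F_def)
  have "lie_bracket (vf_mat k v) Y \<in> \<hh>" if "Y \<in> \<hh>" for Y
  proof -
    obtain w where w: "Y = vf_mat k w" "fps_nth w 0 = 0"
      using \<open>Y \<in> \<hh>\<close> \<hh>_sub k by (auto simp: jet_algebra_eq)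
    then have "fps_nth w 1 = 0" using nil[OF that] k by (simp add: vf_mat_00)
    with w have w2: "fps_nth w i = 0" if "i < 2" for i using that by (auto simp: less_2_cases_iff)
    \<comment> \<open>Here \<open>v\<close> has order at least \<open>m + 1\<close> and
      \<open>w\<close> order at least 2, so both products have order at least
      \<open>m + 2\<close>.\<close>
    have "fps_nth (fps_deriv v * w - v * fps_deriv w) i = 0" if "i \<le> Suc m" for i
      using that v(1) w2 fps_mult_nth_eq_0[of m "fps_deriv v" 2 w i]
        fps_mult_nth_eq_0[of "Suc m" v 1 "fps_deriv w" i] by simp
    then have "lie_bracket (vf_mat k v) Y \<in> F (Suc m)"
      using v(1) w by (auto simp: F_def lie_bracket_vf_mat)
    then show ?thesis using m by blast
  qed
  then have "vf_mat k v \<in> lie_normalizer (jet_algebra k) \<hh>"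
    using v(1)[of 0] k by (auto simp: lie_normalizer_def jet_algebra_eq)
  then show False using norm v(2) by simp
qed

section \<open>Brackets with diagonal matrices\<close>

lemma diagonal_mult_index:
  fixes A B :: "complex mat"
  assumes "A \<in> carrier_mat k k" "B \<in> carrier_mat k k" "i < k" "j < k" "diagonal_mat A"
  shows "(A * B) $$ (i, j) = A $$ (i, i) * B $$ (i, j)"
    and "(B * A) $$ (i, j) = B $$ (i, j) * A $$ (j, j)"
proof -
  have "(\<Sum>m<k. A $$ (i, m) * B $$ (m, j)) = (\<Sum>m\<in>{i}. A $$ (i, m) * B $$ (m, j))"
    using assms by (intro sum.mono_neutral_right) (auto simp: diagonal_mat_def)
  then show "(A * B) $$ (i, j) = A $$ (i, i) * B $$ (i, j)"
    using index_mult_mat_sum[OF assms(1-4)] by simp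
  have "(\<Sum>m<k. B $$ (i, m) * A $$ (m, j)) = (\<Sum>m\<in>{j}. B $$ (i, m) * A $$ (m, j))"
    using assms by (intro sum.mono_neutral_right) (auto simp: diagonal_mat_def)
  then show "(B * A) $$ (i, j) = B $$ (i, j) * A $$ (j, j)"
    using index_mult_mat_sum[OF assms(2,1,3,4)] by simp
qed

lemma lie_bracket_carrier:
  "X \<in> carrier_mat k k \<Longrightarrow> Y \<in> carrier_mat k k \<Longrightarrow> lie_bracket X Y \<in> carrier_mat k k"
  unfolding lie_bracket_def by (intro minus_carrier_mat mult_carrier_mat)

lemma funpow_lie_bracket_carrier:
  "X \<in> carrier_mat k k \<Longrightarrow> Y \<in> carrier_mat k k \<Longrightarrow> (lie_bracket X ^^ n) Y \<in> carrier_mat k k"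
  by (induction n) (simp_all add: lie_bracket_carrier)

text \<open>Matrix units are eigenvectors of bracketing with a diagonal matrix, the eigenvalue being
  the difference of two diagonal entries.\<close>

lemma funpow_lie_bracket_diagonal:
  assumes "A \<in> carrier_mat k k" "B \<in> carrier_mat k k" "i < k" "j < k" "diagonal_mat A"
  shows "(lie_bracket A ^^ n) B $$ (i, j) = (A $$ (i, i) - A $$ (j, j)) ^ n * B $$ (i, j)"
proof (induction n)
  case (Suc n)
  let ?Z = "(lie_bracket A ^^ n) B"
  have Z: "?Z \<in> carrier_mat k k" using assms by (simp add: funpow_lie_bracket_carrier)
  have "lie_bracket A ?Z $$ (i, j) = A $$ (i, i) * ?Z $$ (i, j) - ?Z $$ (i, j) * A $$ (j, j)"
    using assms Z by (simp add: lie_bracket_def diagonal_mult_index[OF assms(1) Z] del: index_mult_mat(1))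
  then show ?case by (simp add: Suc algebra_simps)
qed simp

lemma lie_bracket_diagonal:
  assumes "A \<in> carrier_mat k k" "B \<in> carrier_mat k k" "diagonal_mat A" "diagonal_mat B"
  shows "lie_bracket A B = 0\<^sub>m k k"
proof (rule eq_matI)
  fix i j assume "i < dim_row (0\<^sub>m k k :: complex mat)" "j < dim_col (0\<^sub>m k k :: complex mat)"
  then show "lie_bracket A B $$ (i, j) = (0\<^sub>m k k) $$ (i, j)"
    using funpow_lie_bracket_diagonal[of A k B i j 1] assms
    by (cases "i = j") (auto simp: diagonal_mat_def)
qed (use assms in \<open>auto simp: lie_bracket_def\<close>)

text \<open>Turns nilpotency of the subalgebra into nilpotency of bracketing with one fixed
  element.\<close>

lemma funpow_lie_bracket_lower_central:
  "X \<in> \<hh> \<Longrightarrow> Y \<in> \<hh> \<Longrightarrow> (lie_bracket X ^^ n) Y \<in> lower_central k \<hh> n"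
  by (induction n) (auto intro!: hull_inc)

lemma cartan_subalgebra_commutative:
  assumes k: "k \<ge> 1" and \<hh>: "cartan_subalgebra k (jet_algebra k) \<hh>"
  shows "lie_commutative k \<hh>"
proof -
  obtain X where X: "X \<in> \<hh>" "X $$ (0, 0) \<noteq> 0"
    using cartan_subalgebra_not_nilradical[OF assms] by blast
  have sub: "\<hh> \<subseteq> jet_algebra k" and "lie_nilpotent k \<hh>"
    using \<hh> by (auto simp: cartan_subalgebra_def lie_subalgebra_def)
  then obtain n where n: "lower_central k \<hh> n = {0\<^sub>m k k}"
    by (auto simp: lie_nilpotent_def)
  have car: "Y \<in> carrier_mat k k" if "Y \<in> \<hh>" for Y
    using that sub jet_algebra_carrier by blast
  define E where "E = X $$ (0, 0) \<cdot>\<^sub>m vf_mat k fps_X"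
  have E: "E \<in> carrier_mat k k" by (simp add: E_def)
  obtain g where g: "g \<in> carrier (jet_group k)" "Ad (jet_group k) g X = E"
    using jet_algebra_linearize[OF k] X sub unfolding E_def by blast
  have E_index: "E $$ (i, j) = (if i = j then X $$ (0, 0) * of_nat (Suc i) else 0)"
    if "i < k" "j < k" for i j
    using that by (auto simp: E_def vf_mat_index carrier_matD[OF vf_mat_carrier] simp del: of_nat_Suc)
  have E_diag: "diagonal_mat E"
    using E by (auto simp: diagonal_mat_def E_index)
  have diag: "diagonal_mat (Ad (jet_group k) g Y)" if "Y \<in> \<hh>" for Y
    unfolding diagonal_mat_def
  proof (intro allI impI)
    let ?Z = "Ad (jet_group k) g Y"
    have Z: "?Z \<in> carrier_mat k k" using g car that by (simp add: Ad_carrier)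
    fix i j assume "i < dim_row ?Z" "j < dim_col ?Z" "i \<noteq> j"
    with Z have ij: "i < k" "j < k" "i \<noteq> j" by auto
    \<comment> \<open>Conjugation preserves brackets, so nilpotency of bracketing with
      \<open>X\<close> passes to bracketing with \<open>E\<close>.\<close>
    have "Ad (jet_group k) g ((lie_bracket X ^^ m) Y) = (lie_bracket E ^^ m) ?Z" for m
      using car[OF X(1)] car[OF that] g
      by (induction m) (simp_all add: Ad_lie_bracket funpow_lie_bracket_carrier)
    moreover have "(lie_bracket X ^^ n) Y = 0\<^sub>m k k"
      using funpow_lie_bracket_lower_central[OF X(1) that, of n k] n by simp
    ultimately have "(lie_bracket E ^^ n) ?Z = 0\<^sub>m k k"
      using Ad_zero[OF g(1)] by metis
    then have "(E $$ (i, i) - E $$ (j, j)) ^ n * ?Z $$ (i, j) = 0"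
      using funpow_lie_bracket_diagonal[OF E Z ij(1,2) E_diag, of n] ij by simp
    \<comment> \<open>The diagonal entries of \<open>E\<close> are the multiples by 1, ...,
      \<open>k\<close> of a nonzero number, hence distinct; this forces the off-diagonal entry to
      vanish.\<close>
    moreover have "E $$ (i, i) \<noteq> E $$ (j, j)"
      using ij X(2) by (simp add: E_index del: of_nat_Suc)
    ultimately show "?Z $$ (i, j) = 0" by simp
  qed
  show ?thesis
    unfolding lie_commutative_def
  proof (intro ballI)
    fix Y Z assume "Y \<in> \<hh>" "Z \<in> \<hh>"
    note YZ = car[OF this(1)] car[OF this(2)] diag[OF this(1)] diag[OF this(2)]
    have "Ad (jet_group k) g (lie_bracket Y Z) = 0\<^sub>m k k"
      using YZ g(1) by (simp add: Ad_lie_bracket lie_bracket_diagonal Ad_carrier)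
    then have "lie_bracket Y Z = Ad (jet_group k) (inv\<^bsub>jet_group k\<^esub> g) (0\<^sub>m k k)"
      using Ad_Ad_inv(2)[OF g(1) lie_bracket_carrier[OF YZ(1,2)]] by simp
    then show "lie_bracket Y Z = 0\<^sub>m k k"
      using Ad_zero jet_group_invD(3)[OF g(1)] by simp
  qed
qed

theorem theorem4p1:
  fixes k :: nat
  assumes "k \<ge> 1"
  shows "has_generic_stabilizer k (jet_group k) (Ad (jet_group k))
           (subtopology (zariski k) (jet_algebra k))
       \<and> (\<forall>\<hh>. cartan_subalgebra k (jet_algebra k) \<hh> \<longrightarrow> lie_commutative k \<hh>)"
  using has_generic_stabilizer_Ad[OF assms] cartan_subalgebra_commutative[OF assms] by blast

end
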